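(* Let $F\colon\mathbb{A}^3\to\mathbb{A}^3$, $F(x,y,z)=(a,b,c)$, be the polynomial map over $\mathbb{Q}$ with $$a=(1+xy)^3z+y^2(1+xy)(4+3xy),\quad b=y+3x(1+xy)^2z+3xy^2(4+3xy),\quad c=2x-3x^2y-x^3z.$$ Then $F(\mathbb{Q}^3)$ is a thin set in the sense of Serre. Outside a thin set of rational points $(a,b,c)\in\mathbb{Q}^3$ the fiber $F^{-1}(a,b,c)$ contains no rational point.
   Context: A subset of $\mathbb{A}^n(\mathbb{Q})$ is thin if it is contained in a finite union of sets each of which is either contained in $Z(\mathbb{Q})$ for a proper closed subvariety $Z\subsetneq\mathbb{A}^n$, or of the form $\pi(X(\mathbb{Q}))$ for an irreducible variety $X$ over $\mathbb{Q}$ with $\dim X=n$ and a dominant, generically finite morphism $\pi\colon X\to\mathbb{A}^n$ of degree at least $2$. *)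

theory Defs
  imports
    Complex_Main
    "HOL-Library.Poly_Mapping"
    "HOL-Algebra.QuotRing"
    "HOL-Algebra.Generated_Fields"
    "HOL-Algebra.Finite_Extensions"
begin

section \<open>The polynomial ring \<open>\<rat>[x\<^sub>0, \<dots>, x\<^sub>m\<^sub>-\<^sub>1]\<close>\<close>

text \<open>A polynomial maps monomials (exponent vectors of finite support) to coefficients.\<close>

type_synonym qpoly = "(nat \<Rightarrow>\<^sub>0 nat) \<Rightarrow>\<^sub>0 rat"

definition QPoly :: "nat \<Rightarrow> qpoly ring" where
  "QPoly m = \<lparr>carrier = {p. \<forall>t\<in>Poly_Mapping.keys p. Poly_Mapping.keys t \<subseteq> {..<m}},
              monoid.mult = (*), one = 1, zero = 0, add = (+)\<rparr>"

definition Var :: "nat \<Rightarrow> qpoly" where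
  "Var i = Poly_Mapping.single (Poly_Mapping.single i 1) 1"

text \<open>Points of affine \<open>m\<close>-space over a field of characteristic 0 are lists of length \<open>m\<close>.\<close>

definition peval :: "qpoly \<Rightarrow> 'a::field_char_0 list \<Rightarrow> 'a" where
  "peval p u = (\<Sum>t\<in>Poly_Mapping.keys p. of_rat (Poly_Mapping.lookup p t) *
                 (\<Prod>i\<in>Poly_Mapping.keys t. (u ! i) ^ Poly_Mapping.lookup t i))"

definition affine_space :: "nat \<Rightarrow> 'a::field_char_0 list set" where
  "affine_space m = {u. length u = m}"

definition zero_locus :: "nat \<Rightarrow> qpoly set \<Rightarrow> 'a::field_char_0 list set" where
  "zero_locus m S = {u \<in> affine_space m. \<forall>p\<in>S. peval p u = 0}"


section \<open>Fraction fields\<close>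

definition frac_rel :: "('a, 'b) ring_scheme \<Rightarrow> (('a \<times> 'a) \<times> ('a \<times> 'a)) set" where
  "frac_rel R = {((a, b), (c, d)).
      a \<in> carrier R \<and> b \<in> carrier R - {\<zero>\<^bsub>R\<^esub>} \<and> c \<in> carrier R \<and> d \<in> carrier R - {\<zero>\<^bsub>R\<^esub>} \<and>
      a \<otimes>\<^bsub>R\<^esub> d = c \<otimes>\<^bsub>R\<^esub> b}"

definition mk_frac :: "('a, 'b) ring_scheme \<Rightarrow> 'a \<Rightarrow> 'a \<Rightarrow> ('a \<times> 'a) set" where
  "mk_frac R a b = frac_rel R `` {(a, b)}"

definition Frac :: "('a, 'b) ring_scheme \<Rightarrow> ('a \<times> 'a) set ring" where
  "Frac R = \<lparr>
     carrier = {mk_frac R a b | a b. a \<in> carrier R \<and> b \<in> carrier R - {\<zero>\<^bsub>R\<^esub>}},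
     monoid.mult = (\<lambda>U V. \<Union>(a, b)\<in>U. \<Union>(c, d)\<in>V. mk_frac R (a \<otimes>\<^bsub>R\<^esub> c) (b \<otimes>\<^bsub>R\<^esub> d)),
     one = mk_frac R \<one>\<^bsub>R\<^esub> \<one>\<^bsub>R\<^esub>,
     zero = mk_frac R \<zero>\<^bsub>R\<^esub> \<one>\<^bsub>R\<^esub>,
     add = (\<lambda>U V. \<Union>(a, b)\<in>U. \<Union>(c, d)\<in>V.
              mk_frac R (a \<otimes>\<^bsub>R\<^esub> d \<oplus>\<^bsub>R\<^esub> c \<otimes>\<^bsub>R\<^esub> b) (b \<otimes>\<^bsub>R\<^esub> d))\<rparr>"


section \<open>Irreducible varieties over \<open>\<rat>\<close> and their function fields\<close>

text \<open>
  An irreducible affine variety over \<open>\<rat>\<close> is the subvariety \<open>X = V(P)\<close> of affine \<open>m\<close>-space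
  cut out by a prime ideal \<open>P\<close> of \<open>QPoly m\<close>. Irreducibility is over \<open>\<rat>\<close>, not over its algebraic
  closure. For a field \<open>k\<close> of characteristic 0, \<open>X(k)\<close> is \<open>zero_locus m P :: k list set\<close>.
\<close>

definition coord_ring :: "nat \<Rightarrow> qpoly set \<Rightarrow> qpoly set ring" where
  "coord_ring m P = QPoly m Quot P"

definition function_field :: "nat \<Rightarrow> qpoly set \<Rightarrow> (qpoly set \<times> qpoly set) set ring" where
  "function_field m P = Frac (coord_ring m P)"

definition to_function_field ::
    "nat \<Rightarrow> qpoly set \<Rightarrow> qpoly \<Rightarrow> (qpoly set \<times> qpoly set) set" where
  "to_function_field m P p = mk_frac (coord_ring m P) (P +>\<^bsub>QPoly m\<^esub> p) \<one>\<^bsub>coord_ring m P\<^esub>"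

text \<open>
  A ring homomorphism from \<open>QPoly n\<close> to a field of characteristic 0 is automatically
  \<open>\<rat>\<close>-linear, so the \<open>\<phi>\<close> below is the evaluation homomorphism at \<open>(b 0, \<dots>, b (n - 1))\<close>.
  Likewise \<open>generate_field L H\<close> contains the prime field \<open>\<rat>\<close>, hence is \<open>\<rat>(H)\<close>.
\<close>

definition alg_independent :: "'a ring \<Rightarrow> nat \<Rightarrow> (nat \<Rightarrow> 'a) \<Rightarrow> bool" where
  "alg_independent L n b \<longleftrightarrow>
     (\<exists>\<phi>\<in>ring_hom (QPoly n) L. (\<forall>i<n. \<phi> (Var i) = b i) \<and> inj_on \<phi> (carrier (QPoly n)))"

definition has_trdeg :: "'a ring \<Rightarrow> nat \<Rightarrow> bool" where
  "has_trdeg L n \<longleftrightarrow>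
     (\<exists>b. alg_independent L n b \<and>
          (\<forall>x\<in>carrier L. ring.algebraic L (generate_field L (b ` {..<n})) x))"

text \<open>The dimension of a variety is the transcendence degree of its function field over \<open>\<rat>\<close>.\<close>

definition has_dim :: "nat \<Rightarrow> qpoly set \<Rightarrow> nat \<Rightarrow> bool" where
  "has_dim m P n \<longleftrightarrow> has_trdeg (function_field m P) n"


section \<open>Morphisms to affine space\<close>

text \<open>
  A morphism from \<open>V(P)\<close> to affine \<open>n\<close>-space is given by \<open>n\<close> regular functions, which are
  restrictions of polynomials \<open>fs = [f\<^sub>1, \<dots>, f\<^sub>n]\<close> in \<open>QPoly m\<close>.
\<close>

definition morphism :: "nat \<Rightarrow> nat \<Rightarrow> qpoly list \<Rightarrow> bool" where
  "morphism m n fs \<longleftrightarrow> length fs = n \<and> set fs \<subseteq> carrier (QPoly m)"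

definition apply_morphism :: "qpoly list \<Rightarrow> 'a::field_char_0 list \<Rightarrow> 'a list" where
  "apply_morphism fs u = map (\<lambda>f. peval f u) fs"

text \<open>
  The image is Zariski dense. It is tested on geometric (complex) points, since the
  rational points of \<open>V(P)\<close> need not be dense in \<open>V(P)\<close>.
\<close>

definition dominant :: "nat \<Rightarrow> qpoly set \<Rightarrow> qpoly list \<Rightarrow> bool" where
  "dominant m P fs \<longleftrightarrow>
     (\<forall>g\<in>carrier (QPoly (length fs)).
        (\<forall>u\<in>(zero_locus m P :: complex list set). peval g (apply_morphism fs u) = 0) \<longrightarrow> g = 0)"

text \<open>
  For a dominant morphism, pullback identifies the function field of affine space with the
  subfield \<open>\<rat>(f\<^sub>1, \<dots>, f\<^sub>n)\<close> of the function field of \<open>V(P)\<close>. The morphism is generically finite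
  of degree \<open>d\<close> if the function field has finite dimension \<open>d\<close> over that subfield.
\<close>

definition generically_finite_of_degree ::
    "nat \<Rightarrow> qpoly set \<Rightarrow> qpoly list \<Rightarrow> nat \<Rightarrow> bool" where
  "generically_finite_of_degree m P fs d \<longleftrightarrow>
     ring.dimension (function_field m P) d
       (generate_field (function_field m P) (to_function_field m P ` set fs))
       (carrier (function_field m P))"


section \<open>Thin sets\<close>

text \<open>
  A closed subvariety \<open>Z\<close> of affine space is the zero locus of an ideal (not necessarily prime,
  which is immaterial up to finite unions). It is proper if it misses a geometric point.
\<close>

definition thin_type1 :: "nat \<Rightarrow> rat list set \<Rightarrow> bool" where
  "thin_type1 n C \<longleftrightarrow>
     (\<exists>I. ideal I (QPoly n) \<and> (zero_locus n I :: complex list set) \<noteq> affine_space n \<and>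
          C \<subseteq> zero_locus n I)"

text \<open>
  It suffices to let \<open>X\<close> be affine: an arbitrary irreducible variety \<open>X\<close> is a finite union of
  nonempty affine open subvarieties \<open>U\<close>, each with the function field of \<open>X\<close>. Hence \<open>\<pi>\<close> restricts
  to a dominant, generically finite morphism of the same degree on each \<open>U\<close>, and \<open>\<pi>(X(\<rat>))\<close> is
  the finite union of the sets \<open>\<pi>(U(\<rat>))\<close>.
\<close>

definition thin_type2 :: "nat \<Rightarrow> rat list set \<Rightarrow> bool" where
  "thin_type2 n C \<longleftrightarrow>
     (\<exists>m P fs d. primeideal P (QPoly m) \<and> has_dim m P n \<and>
        morphism m n fs \<and> dominant m P fs \<and>
        generically_finite_of_degree m P fs d \<and> d \<ge> 2 \<and>
        C = apply_morphism fs ` zero_locus m P)"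

definition thin :: "nat \<Rightarrow> rat list set \<Rightarrow> bool" where
  "thin n T \<longleftrightarrow> T \<subseteq> affine_space n \<and>
     (\<exists>\<C>. finite \<C> \<and> (\<forall>C\<in>\<C>. thin_type1 n C \<or> thin_type2 n C) \<and> T \<subseteq> \<Union>\<C>)"


section \<open>The map \<open>F\<close>\<close>

definition Fmap :: "rat \<Rightarrow> rat \<Rightarrow> rat \<Rightarrow> rat list" where
  "Fmap x y z =
     [(1 + x * y) ^ 3 * z + y ^ 2 * (1 + x * y) * (4 + 3 * x * y),
      y + 3 * x * (1 + x * y) ^ 2 * z + 3 * x * y ^ 2 * (4 + 3 * x * y),
      2 * x - 3 * x ^ 2 * y - x ^ 3 * z]"

end

theory Submission
  imports Defs "HOL-Computational_Algebra.Fundamental_Theorem_Algebra"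
begin

text \<open>
  Rational points in the image of \<open>F\<close> make a certain cubic equation solvable in \<open>\<rat>\<close>. If
  \<open>F(x, y, z) = (a, b, c)\<close> with \<open>x \<noteq> 0\<close>, then \<open>s = (1 + x y) / (2 x)\<close> is a root of
  \<open>4 c s^3 - 4 s^2 + b s = a\<close>. A point with a rational preimage therefore either lies on the plane
  \<open>c = 0\<close>, or gives a cubic with a rational root. The second condition says that the point lies in
  the image of the rational points under the morphism
  \<open>(s, b, c) \<mapsto> (4 c s^3 - 4 s^2 + b s, b, c)\<close> of affine 3-space to itself
  (\<open>Fmap_in_root_cover_image\<close>). The plane is a thin set of the first type, and the image of the
  morphism is one of the second type. The set of points outside of which fibres have no rational
  point can be taken to be \<open>F(\<rat>\<^sup>3)\<close> itself.

  For the second type, the source is affine space, that is, the zero ideal. Its function field is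
  generated by \<open>s, b, c\<close>, so it has transcendence degree 3 (\<open>affine_space_has_dim\<close>). The morphism
  is surjective on complex points because a nonconstant polynomial has a root
  (\<open>root_cover_dominant\<close>). The function field arises from the subfield generated by the coordinates
  of the morphism by adjoining the algebraic element \<open>s\<close>, so the degree is finite, and it is at
  least 2 as soon as \<open>s\<close> is not in the subfield. If it were, then
  \<open>s Q(f(s), b, c) = P(f(s), b, c)\<close> with \<open>f(s) = 4 c s^3 - 4 s^2 + b s\<close>, and the degrees in \<open>s\<close> of
  the two sides would be 1 and 0 modulo 3 (\<open>root_not_fraction_of_pullbacks\<close>).
\<close>

section \<open>Fraction fields of domains\<close>

context domain
begin

lemma frac_rel_equiv: "equiv (carrier R \<times> (carrier R - {\<zero>})) (frac_rel R)"
proof (rule equivI)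
  show "refl_on (carrier R \<times> (carrier R - {\<zero>})) (frac_rel R)"
    by (auto simp: refl_on_def frac_rel_def)
  show "frac_rel R \<subseteq> (carrier R \<times> (carrier R - {\<zero>})) \<times> (carrier R \<times> (carrier R - {\<zero>}))"
    by (auto simp: frac_rel_def)
  show "sym (frac_rel R)"
    by (auto simp: sym_def frac_rel_def)
  show "trans (frac_rel R)"
  proof (clarsimp simp: trans_def frac_rel_def)
    fix a b c d e f
    assume carr: "a \<in> carrier R" "b \<in> carrier R" "c \<in> carrier R" "d \<in> carrier R"
        "e \<in> carrier R" "f \<in> carrier R"
      and "d \<noteq> \<zero>" and eqs: "a \<otimes> d = c \<otimes> b" "c \<otimes> f = e \<otimes> d"
    have "(a \<otimes> f) \<otimes> d = (a \<otimes> d) \<otimes> f" using carr by (simp add: m_ac)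
    also have "\<dots> = (c \<otimes> f) \<otimes> b" using carr by (simp add: m_ac eqs(1))
    also have "\<dots> = (e \<otimes> b) \<otimes> d" using carr by (simp add: m_ac eqs(2))
    finally show "a \<otimes> f = e \<otimes> b" using carr \<open>d \<noteq> \<zero>\<close> m_rcancel by simp
  qed
qed

lemma mk_frac_eq_iff:
  assumes "a \<in> carrier R" "b \<in> carrier R - {\<zero>}" "c \<in> carrier R" "d \<in> carrier R - {\<zero>}"
  shows "mk_frac R a b = mk_frac R c d \<longleftrightarrow> a \<otimes> d = c \<otimes> b"
  using eq_equiv_class_iff[OF frac_rel_equiv, of "(a, b)" "(c, d)"] assms
  by (auto simp: mk_frac_def frac_rel_def)

lemma mem_mk_frac_iff:
  assumes "a \<in> carrier R" "b \<in> carrier R - {\<zero>}"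
  shows "(c, d) \<in> mk_frac R a b \<longleftrightarrow> c \<in> carrier R \<and> d \<in> carrier R - {\<zero>} \<and> a \<otimes> d = c \<otimes> b"
  using assms by (auto simp: mk_frac_def frac_rel_def)

lemma mk_frac_mult:
  assumes "a \<in> carrier R" "b \<in> carrier R - {\<zero>}" "c \<in> carrier R" "d \<in> carrier R - {\<zero>}"
  shows "mk_frac R a b \<otimes>\<^bsub>Frac R\<^esub> mk_frac R c d = mk_frac R (a \<otimes> c) (b \<otimes> d)"
proof -
  have *: "mk_frac R (a' \<otimes> c') (b' \<otimes> d') = mk_frac R (a \<otimes> c) (b \<otimes> d)"
    if "(a', b') \<in> mk_frac R a b" "(c', d') \<in> mk_frac R c d" for a' b' c' d'
  proof -
    have m: "a' \<in> carrier R" "b' \<in> carrier R - {\<zero>}" "c' \<in> carrier R" "d' \<in> carrier R - {\<zero>}"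
      and eqs: "a \<otimes> b' = a' \<otimes> b" "c \<otimes> d' = c' \<otimes> d"
      using that assms by (auto simp: mem_mk_frac_iff)
    have "(a' \<otimes> c') \<otimes> (b \<otimes> d) = (a' \<otimes> b) \<otimes> (c' \<otimes> d)"
      using m assms by (simp add: m_ac)
    also have "\<dots> = (a \<otimes> c) \<otimes> (b' \<otimes> d')"
      using m assms by (simp add: m_ac flip: eqs)
    finally show ?thesis using m assms by (subst mk_frac_eq_iff) (auto simp: integral_iff)
  qed
  have "(a, b) \<in> mk_frac R a b" "(c, d) \<in> mk_frac R c d"
    using assms by (auto simp: mem_mk_frac_iff)
  moreover have "mk_frac R a b \<otimes>\<^bsub>Frac R\<^esub> mk_frac R c d =
      (\<Union>(a', b')\<in>mk_frac R a b. \<Union>(c', d')\<in>mk_frac R c d. mk_frac R (a \<otimes> c) (b \<otimes> d))"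
    unfolding Frac_def ring.simps monoid.simps by (rule SUP_cong[OF refl], clarify, rule SUP_cong[OF refl], clarify, rule *)
  ultimately show ?thesis by auto
qed

lemma mk_frac_add:
  assumes "a \<in> carrier R" "b \<in> carrier R - {\<zero>}" "c \<in> carrier R" "d \<in> carrier R - {\<zero>}"
  shows "mk_frac R a b \<oplus>\<^bsub>Frac R\<^esub> mk_frac R c d = mk_frac R (a \<otimes> d \<oplus> c \<otimes> b) (b \<otimes> d)"
proof -
  have *: "mk_frac R (a' \<otimes> d' \<oplus> c' \<otimes> b') (b' \<otimes> d') = mk_frac R (a \<otimes> d \<oplus> c \<otimes> b) (b \<otimes> d)"
    if "(a', b') \<in> mk_frac R a b" "(c', d') \<in> mk_frac R c d" for a' b' c' d'
  proof -
    have m: "a' \<in> carrier R" "b' \<in> carrier R - {\<zero>}" "c' \<in> carrier R" "d' \<in> carrier R - {\<zero>}"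
      and eqs: "a \<otimes> b' = a' \<otimes> b" "c \<otimes> d' = c' \<otimes> d"
      using that assms by (auto simp: mem_mk_frac_iff)
    have "(a' \<otimes> d' \<oplus> c' \<otimes> b') \<otimes> (b \<otimes> d) = (a' \<otimes> b) \<otimes> (d \<otimes> d') \<oplus> (c' \<otimes> d) \<otimes> (b \<otimes> b')"
      using m assms by (simp add: l_distr r_distr m_ac)
    also have "\<dots> = (a \<otimes> d \<oplus> c \<otimes> b) \<otimes> (b' \<otimes> d')"
      using m assms by (simp add: l_distr r_distr m_ac flip: eqs)
    finally show ?thesis using m assms by (subst mk_frac_eq_iff) (auto simp: integral_iff)
  qed
  have "(a, b) \<in> mk_frac R a b" "(c, d) \<in> mk_frac R c d"
    using assms by (auto simp: mem_mk_frac_iff)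
  moreover have "mk_frac R a b \<oplus>\<^bsub>Frac R\<^esub> mk_frac R c d =
      (\<Union>(a', b')\<in>mk_frac R a b. \<Union>(c', d')\<in>mk_frac R c d. mk_frac R (a \<otimes> d \<oplus> c \<otimes> b) (b \<otimes> d))"
    unfolding Frac_def ring.simps monoid.simps by (rule SUP_cong[OF refl], clarify, rule SUP_cong[OF refl], clarify, rule *)
  ultimately show ?thesis by auto
qed

lemma Frac_zero: "\<zero>\<^bsub>Frac R\<^esub> = mk_frac R \<zero> \<one>" and Frac_one: "\<one>\<^bsub>Frac R\<^esub> = mk_frac R \<one> \<one>"
  by (simp_all add: Frac_def)

lemma mk_frac_in_Frac:
  assumes "a \<in> carrier R" "b \<in> carrier R - {\<zero>}"
  shows "mk_frac R a b \<in> carrier (Frac R)"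
  using assms by (auto simp: Frac_def)

lemma Frac_cases:
  assumes "x \<in> carrier (Frac R)"
  obtains a b where "a \<in> carrier R" "b \<in> carrier R - {\<zero>}" "x = mk_frac R a b"
  using assms by (auto simp: Frac_def)

text \<open>
  These rules turn every identity between explicit fractions into an identity between numerators
  in the domain, so that the ring and field laws below follow from commutativity and
  distributivity alone.
\<close>

lemmas mk_frac_simps = mk_frac_mult mk_frac_add mk_frac_eq_iff mk_frac_in_Frac integral_iff
  Frac_zero Frac_one

lemma Frac_cring: "cring (Frac R)"
proof (rule cringI)
  show "abelian_group (Frac R)"
  proof (rule abelian_groupI)
    fix x y assume "x \<in> carrier (Frac R)" "y \<in> carrier (Frac R)"
    then show "x \<oplus>\<^bsub>Frac R\<^esub> y \<in> carrier (Frac R)" and "x \<oplus>\<^bsub>Frac R\<^esub> y = y \<oplus>\<^bsub>Frac R\<^esub> x"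
      by (elim Frac_cases; simp add: mk_frac_simps m_ac a_ac)+
  next
    fix x y z assume "x \<in> carrier (Frac R)" "y \<in> carrier (Frac R)" "z \<in> carrier (Frac R)"
    then show "x \<oplus>\<^bsub>Frac R\<^esub> y \<oplus>\<^bsub>Frac R\<^esub> z = x \<oplus>\<^bsub>Frac R\<^esub> (y \<oplus>\<^bsub>Frac R\<^esub> z)"
      by (elim Frac_cases; simp add: mk_frac_simps l_distr r_distr m_ac a_ac)
  next
    fix x assume "x \<in> carrier (Frac R)"
    then obtain a b where ab: "a \<in> carrier R" "b \<in> carrier R - {\<zero>}" "x = mk_frac R a b"
      by (rule Frac_cases)
    then show "\<exists>y\<in>carrier (Frac R). y \<oplus>\<^bsub>Frac R\<^esub> x = \<zero>\<^bsub>Frac R\<^esub>"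
      by (intro bexI[of _ "mk_frac R (\<ominus> a) b"]) (simp_all add: mk_frac_simps l_minus l_neg)
    show "\<zero>\<^bsub>Frac R\<^esub> \<oplus>\<^bsub>Frac R\<^esub> x = x" using ab by (simp add: mk_frac_simps)
  qed (simp add: mk_frac_simps)
  show "comm_monoid (Frac R)"
  proof (rule comm_monoidI)
    fix x y assume "x \<in> carrier (Frac R)" "y \<in> carrier (Frac R)"
    then show "x \<otimes>\<^bsub>Frac R\<^esub> y \<in> carrier (Frac R)" and "x \<otimes>\<^bsub>Frac R\<^esub> y = y \<otimes>\<^bsub>Frac R\<^esub> x"
      by (elim Frac_cases; simp add: mk_frac_simps m_ac)+
  next
    fix x y z assume "x \<in> carrier (Frac R)" "y \<in> carrier (Frac R)" "z \<in> carrier (Frac R)"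
    then show "x \<otimes>\<^bsub>Frac R\<^esub> y \<otimes>\<^bsub>Frac R\<^esub> z = x \<otimes>\<^bsub>Frac R\<^esub> (y \<otimes>\<^bsub>Frac R\<^esub> z)"
      by (elim Frac_cases; simp add: mk_frac_simps m_ac)
  next
    fix x assume "x \<in> carrier (Frac R)"
    then show "\<one>\<^bsub>Frac R\<^esub> \<otimes>\<^bsub>Frac R\<^esub> x = x"
      by (elim Frac_cases; simp add: mk_frac_simps)
  qed (simp add: mk_frac_simps)
  fix x y z assume "x \<in> carrier (Frac R)" "y \<in> carrier (Frac R)" "z \<in> carrier (Frac R)"
  then show "(x \<oplus>\<^bsub>Frac R\<^esub> y) \<otimes>\<^bsub>Frac R\<^esub> z = x \<otimes>\<^bsub>Frac R\<^esub> z \<oplus>\<^bsub>Frac R\<^esub> y \<otimes>\<^bsub>Frac R\<^esub> z"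
    by (elim Frac_cases; simp add: mk_frac_simps l_distr r_distr m_ac a_ac)
qed

lemma Frac_field: "field (Frac R)"
proof (rule cring.cring_fieldI2[OF Frac_cring])
  show "\<zero>\<^bsub>Frac R\<^esub> \<noteq> \<one>\<^bsub>Frac R\<^esub>" by (simp add: mk_frac_simps)
  fix x assume "x \<in> carrier (Frac R)" "x \<noteq> \<zero>\<^bsub>Frac R\<^esub>"
  then obtain a b where "a \<in> carrier R - {\<zero>}" "b \<in> carrier R - {\<zero>}" "x = mk_frac R a b"
    by (elim Frac_cases) (auto simp: mk_frac_simps)
  then show "\<exists>y\<in>carrier (Frac R). x \<otimes>\<^bsub>Frac R\<^esub> y = \<one>\<^bsub>Frac R\<^esub>"
    by (intro bexI[of _ "mk_frac R b a"]) (simp_all add: mk_frac_simps m_ac)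
qed

lemma mk_frac_ring_hom: "(\<lambda>a. mk_frac R a \<one>) \<in> ring_hom R (Frac R)"
  by (rule ring_hom_memI) (simp_all add: mk_frac_simps)

text \<open>
  Fractions are quotients of elements of the domain. From here on the construction by equivalence
  classes is not looked into again.
\<close>

lemma Frac_quotient:
  assumes "x \<in> carrier (Frac R)"
  obtains a b where "a \<in> carrier R" "b \<in> carrier R - {\<zero>}"
    "x = mk_frac R a \<one> \<otimes>\<^bsub>Frac R\<^esub> inv\<^bsub>Frac R\<^esub> mk_frac R b \<one>"
proof -
  interpret Q: field "Frac R" by (rule Frac_field)
  obtain a b where ab: "a \<in> carrier R" "b \<in> carrier R - {\<zero>}" and x: "x = mk_frac R a b"
    using assms by (rule Frac_cases)
  have "mk_frac R b \<one> \<otimes>\<^bsub>Frac R\<^esub> mk_frac R \<one> b = \<one>\<^bsub>Frac R\<^esub>"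
    using ab by (simp add: mk_frac_simps)
  then have "inv\<^bsub>Frac R\<^esub> mk_frac R b \<one> = mk_frac R \<one> b"
    using ab by (intro Q.comm_inv_char) (simp_all add: mk_frac_simps)
  then have "x = mk_frac R a \<one> \<otimes>\<^bsub>Frac R\<^esub> inv\<^bsub>Frac R\<^esub> mk_frac R b \<one>"
    using ab by (simp add: x mk_frac_simps)
  then show thesis using ab that by blast
qed

end

section \<open>Generated fields and simple extensions\<close>

text \<open>
  If a field is generated over a subfield \<open>E\<close> by one algebraic element \<open>x\<close>, its dimension over
  \<open>E\<close> is the degree of the minimal polynomial of \<open>x\<close>. A monic minimal polynomial of degree 1
  has its root in \<open>E\<close>. So a lower bound on the degree needs no irreducibility proof, only
  \<open>x \<notin> E\<close>.
\<close>

lemma (in field) dimension_ge_2_of_simple_extension: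
  assumes E: "subfield E R" and x: "x \<in> carrier R" "x \<notin> E" "(algebraic over E) x"
    and gen: "\<And>E'. subfield E' R \<Longrightarrow> E \<subseteq> E' \<Longrightarrow> x \<in> E' \<Longrightarrow> E' = carrier R"
  shows "\<exists>d\<ge>2. dimension d E (carrier R)"
proof (intro exI conjI)
  have E_sub: "subring E R" by (rule subfieldE(1)[OF E])
  have "simple_extension E x = carrier R"
    using simple_extension_is_subfield[OF E x(1)] x E_sub
    by (intro gen simple_extension_incl simple_extension_mem) (auto dest: subringE(1))
  then show "dimension (length (Irr E x) - 1) E (carrier R)"
    using dimension_simple_extension[OF E x(1,3)] by simp
  note Irr = IrrE[OF E x(1,3)]
  have "length (Irr E x) - 1 \<ge> 1" by (rule pirreducible_degree[OF E Irr(1,2)])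
  moreover have "length (Irr E x) - 1 \<noteq> 1"
  proof
    assume "length (Irr E x) - 1 = 1"
    then obtain a b where ab: "Irr E x = [a, b]"
      by (cases "Irr E x" rule: list.exhaust; cases "tl (Irr E x)") auto
    then have "a = \<one>" "b \<in> E"
      using Irr(1,3) by (auto simp: univ_poly_def polynomial_def)
    moreover from this have "b \<in> carrier R" using subringE(1)[OF E_sub] by blast
    ultimately have "x \<oplus> b = \<zero>" "b \<in> carrier R"
      using Irr(4) x(1) ab by simp_all
    then have "x = \<ominus> b" using x(1) by (metis minus_equality)
    then show False using x(2) subringE(5)[OF E_sub \<open>b \<in> E\<close>] by simp
  qed
  ultimately show "2 \<le> length (Irr E x) - 1" by simp
qed

text \<open>
  Elements of the field generated by the image of \<open>F\<close> are fractions \<open>h N / h D\<close> with \<open>N\<close> and \<open>D\<close>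
  in any chosen subring \<open>T\<close> that contains \<open>F\<close>. The equation is written as \<open>x \<otimes> h D = h N\<close> because
  this form passes through sums, products and inverses without dividing.
\<close>

lemma (in ring_hom_ring) generate_field_fractions:
  assumes "field S" "subring T R" "F \<subseteq> T" and x: "x \<in> generate_field S (h ` F)"
  shows "x \<in> carrier S \<and> (\<exists>N\<in>T. \<exists>D\<in>T. h D \<noteq> \<zero>\<^bsub>S\<^esub> \<and> x \<otimes>\<^bsub>S\<^esub> h D = h N)"
proof -
  interpret S: field S by fact
  note T = subringE[OF \<open>subring T R\<close>]
  have TS: "h t \<in> carrier S" "t \<in> carrier R" if "t \<in> T" for t using that T(1) by auto
  show ?thesis
    using x
  proof (induction rule: generate_field.induct)
    case one
    then show ?case using T(3) hom_one by (auto intro!: bexI[of _ \<one>])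
  next
    case (incl x)
    then obtain f where "f \<in> T" "x = h f" using \<open>F \<subseteq> T\<close> by auto
    then show ?case using T(3) hom_one TS by (intro conjI bexI[of _ f] bexI[of _ \<one>]) auto
  next
    case (a_inv x)
    then obtain N D where "x \<in> carrier S" "N \<in> T" "D \<in> T" "h D \<noteq> \<zero>\<^bsub>S\<^esub>" "x \<otimes>\<^bsub>S\<^esub> h D = h N" by auto
    then show ?case using T(5) TS by (intro conjI bexI[of _ "\<ominus> N"] bexI[of _ D]) (auto simp: S.l_minus)
  next
    case (m_inv x)
    then obtain N D where ND: "x \<in> carrier S" "N \<in> T" "D \<in> T" "h D \<noteq> \<zero>\<^bsub>S\<^esub>" "x \<otimes>\<^bsub>S\<^esub> h D = h N"
      by auto
    have "h N \<noteq> \<zero>\<^bsub>S\<^esub>" using ND m_inv.hyps TS S.integral by metis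
    moreover have "x \<in> Units S" using ND m_inv.hyps by (simp add: S.field_Units)
    moreover from \<open>x \<in> Units S\<close> have "inv\<^bsub>S\<^esub> x \<otimes>\<^bsub>S\<^esub> (x \<otimes>\<^bsub>S\<^esub> h D) = h D"
      using ND(1,3) TS by (simp flip: S.m_assoc)
    ultimately show ?case
      using ND \<open>x \<in> Units S\<close> by (intro conjI bexI[of _ D] bexI[of _ N]) auto
  next
    case (eng_add x y)
    then obtain N D N' D' where ND: "x \<in> carrier S" "N \<in> T" "D \<in> T" "h D \<noteq> \<zero>\<^bsub>S\<^esub>" "x \<otimes>\<^bsub>S\<^esub> h D = h N"
      "y \<in> carrier S" "N' \<in> T" "D' \<in> T" "h D' \<noteq> \<zero>\<^bsub>S\<^esub>" "y \<otimes>\<^bsub>S\<^esub> h D' = h N'"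
      by auto
    have "(x \<oplus>\<^bsub>S\<^esub> y) \<otimes>\<^bsub>S\<^esub> h (D \<otimes> D') = (x \<otimes>\<^bsub>S\<^esub> h D) \<otimes>\<^bsub>S\<^esub> h D' \<oplus>\<^bsub>S\<^esub> (y \<otimes>\<^bsub>S\<^esub> h D') \<otimes>\<^bsub>S\<^esub> h D"
      using ND(1-4,6-9) TS by (simp add: S.l_distr S.r_distr S.m_ac)
    then have "(x \<oplus>\<^bsub>S\<^esub> y) \<otimes>\<^bsub>S\<^esub> h (D \<otimes> D') = h (N \<otimes> D' \<oplus> N' \<otimes> D)"
      using ND TS by simp
    moreover have "h (D \<otimes> D') \<noteq> \<zero>\<^bsub>S\<^esub>" using ND TS by (simp add: S.integral_iff)
    moreover have "N \<otimes> D' \<oplus> N' \<otimes> D \<in> T" "D \<otimes> D' \<in> T" using ND T(6,7) by auto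
    ultimately show ?case using ND(1,6) by blast
  next
    case (eng_mult x y)
    then obtain N D N' D' where ND: "x \<in> carrier S" "N \<in> T" "D \<in> T" "h D \<noteq> \<zero>\<^bsub>S\<^esub>" "x \<otimes>\<^bsub>S\<^esub> h D = h N"
      "y \<in> carrier S" "N' \<in> T" "D' \<in> T" "h D' \<noteq> \<zero>\<^bsub>S\<^esub>" "y \<otimes>\<^bsub>S\<^esub> h D' = h N'"
      by auto
    have "(x \<otimes>\<^bsub>S\<^esub> y) \<otimes>\<^bsub>S\<^esub> h (D \<otimes> D') = (x \<otimes>\<^bsub>S\<^esub> h D) \<otimes>\<^bsub>S\<^esub> (y \<otimes>\<^bsub>S\<^esub> h D')"
      using ND(1-4,6-9) TS by (simp add: S.m_ac)
    then have "(x \<otimes>\<^bsub>S\<^esub> y) \<otimes>\<^bsub>S\<^esub> h (D \<otimes> D') = h (N \<otimes> N')"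
      using ND TS by simp
    moreover have "h (D \<otimes> D') \<noteq> \<zero>\<^bsub>S\<^esub>" using ND TS by (simp add: S.integral_iff)
    moreover have "N \<otimes> N' \<in> T" "D \<otimes> D' \<in> T" using ND T(6) by auto
    ultimately show ?case using ND(1,6) by blast
  qed
qed

section \<open>Rational polynomials as functions\<close>

definition monomial_value :: "'a::field_char_0 list \<Rightarrow> (nat \<Rightarrow>\<^sub>0 nat) \<Rightarrow> 'a" where
  "monomial_value u t = (\<Prod>i\<in>Poly_Mapping.keys t. (u ! i) ^ Poly_Mapping.lookup t i)"

lemma monomial_value_superset:
  assumes "finite A" "Poly_Mapping.keys t \<subseteq> A"
  shows "monomial_value u t = (\<Prod>i\<in>A. (u ! i) ^ Poly_Mapping.lookup t i)"
  unfolding monomial_value_def using assms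
  by (intro prod.mono_neutral_left) (auto simp: in_keys_iff)

lemma monomial_value_zero [simp]: "monomial_value u 0 = 1"
  by (simp add: monomial_value_def)

lemma monomial_value_add: "monomial_value u (s + t) = monomial_value u s * monomial_value u t"
proof -
  let ?A = "Poly_Mapping.keys s \<union> Poly_Mapping.keys t"
  have "monomial_value u r = (\<Prod>i\<in>?A. (u ! i) ^ Poly_Mapping.lookup r i)" if "r \<in> {s, t, s + t}" for r
    using that Poly_Mapping.keys_add[of s t] by (intro monomial_value_superset) auto
  then show ?thesis by (simp add: lookup_add power_add prod.distrib)
qed

lemma peval_monomials:
  "peval p u = (\<Sum>t\<in>Poly_Mapping.keys p. of_rat (Poly_Mapping.lookup p t) * monomial_value u t)"
  by (simp add: peval_def monomial_value_def)

lemma peval_superset: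
  assumes "finite A" "Poly_Mapping.keys p \<subseteq> A"
  shows "peval p u = (\<Sum>t\<in>A. of_rat (Poly_Mapping.lookup p t) * monomial_value u t)"
  unfolding peval_monomials using assms
  by (intro sum.mono_neutral_left) (auto simp: in_keys_iff)

lemma peval_zero [simp]: "peval 0 u = 0"
  by (simp add: peval_def)

lemma peval_single [simp]: "peval (Poly_Mapping.single t c) u = of_rat c * monomial_value u t"
  by (subst peval_superset[of "{t}"]) auto

lemma peval_one [simp]: "peval 1 u = 1"
  using peval_single[of 0 1 u] by (simp del: peval_single)

lemma peval_Var [simp]: "peval (Var i) u = u ! i"
  by (simp add: Var_def monomial_value_def)

lemma Var_nonzero: "Var i \<noteq> 0"
proof
  assume "Var i = 0"
  then have "peval (Var i) (replicate (Suc i) (1 :: rat)) = 0" by simp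
  then show False by (simp del: replicate.simps)
qed

lemma peval_add [simp]: "peval (p + q) u = peval p u + peval q u"
proof -
  let ?A = "Poly_Mapping.keys p \<union> Poly_Mapping.keys q"
  have "peval r u = (\<Sum>t\<in>?A. of_rat (Poly_Mapping.lookup r t) * monomial_value u t)"
    if "r \<in> {p, q, p + q}" for r
    using that Poly_Mapping.keys_add[of p q] by (intro peval_superset) auto
  then show ?thesis by (simp add: lookup_add of_rat_add distrib_right sum.distrib)
qed

lemma peval_minus [simp]: "peval (- p) u = - peval p u"
  using peval_add[of p "- p" u] by (simp add: eq_neg_iff_add_eq_0 add.commute)

lemma peval_diff [simp]: "peval (p - q) u = peval p u - peval q u"
  using peval_add[of p "- q" u] by simp

lemma peval_sum: "peval (sum f A) u = (\<Sum>a\<in>A. peval (f a) u)"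
  by (induction A rule: infinite_finite_induct) auto

lemma sum_monomials:
  "(\<Sum>t\<in>Poly_Mapping.keys p. Poly_Mapping.single t (Poly_Mapping.lookup p t)) = p"
  by (rule poly_mapping_eqI) (auto simp: lookup_sum lookup_single when_def in_keys_iff)

lemma peval_mult [simp]: "peval (p * q) u = peval p u * peval q u"
proof -
  have "p * q = (\<Sum>s\<in>Poly_Mapping.keys p. \<Sum>t\<in>Poly_Mapping.keys q.
      Poly_Mapping.single (s + t) (Poly_Mapping.lookup p s * Poly_Mapping.lookup q t))"
    by (subst (1 2) sum_monomials[symmetric]) (simp only: sum_product mult_single)
  then have "peval (p * q) u = (\<Sum>s\<in>Poly_Mapping.keys p. \<Sum>t\<in>Poly_Mapping.keys q.
      of_rat (Poly_Mapping.lookup p s * Poly_Mapping.lookup q t) * monomial_value u (s + t))"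
    by (simp only: peval_sum peval_single)
  also have "\<dots> = peval p u * peval q u"
    by (simp add: peval_monomials monomial_value_add of_rat_mult sum_product mult_ac)
  finally show ?thesis .
qed

lemma peval_power [simp]: "peval (p ^ k) u = peval p u ^ k"
  by (induction k) auto

lemma peval_of_nat [simp]: "peval (of_nat k) u = of_nat k"
  by (induction k) auto

lemma peval_numeral [simp]: "peval (numeral k) u = numeral k"
  using peval_of_nat[of "numeral k" u] by (simp del: peval_of_nat)

text \<open>
  Uniqueness of base \<open>N\<close> expansions, for the substitution in the next lemma.
\<close>

lemma digits_unique:
  fixes a b :: "nat \<Rightarrow> nat"
  assumes "(\<Sum>i<m. a i * N ^ i) = (\<Sum>i<m. b i * N ^ i)"
    and "\<And>i. i < m \<Longrightarrow> a i < N" "\<And>i. i < m \<Longrightarrow> b i < N" and "i < m"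
  shows "a i = b i"
  using assms
proof (induction m arbitrary: a b i)
  case (Suc m)
  have shift: "(\<Sum>i<Suc m. f i * N ^ i) = f 0 + N * (\<Sum>i<m. f (Suc i) * N ^ i)" for f :: "nat \<Rightarrow> nat"
    by (subst sum.lessThan_Suc_shift) (simp add: sum_distrib_left mult_ac)
  let ?A = "\<Sum>i<m. a (Suc i) * N ^ i" and ?B = "\<Sum>i<m. b (Suc i) * N ^ i"
  have eq: "a 0 + N * ?A = b 0 + N * ?B" and lt: "a 0 < N" "b 0 < N"
    using Suc.prems by (simp_all only: shift zero_less_Suc)
  have "(a 0 + N * ?A) mod N = (b 0 + N * ?B) mod N" "(a 0 + N * ?A) div N = (b 0 + N * ?B) div N"
    by (simp_all only: eq)
  then have "a 0 = b 0" and "?A = ?B" using lt by auto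
  then show ?case
    using Suc.IH[of "a \<circ> Suc" "b \<circ> Suc"] Suc.prems(2-4) by (cases i) auto
qed simp

text \<open>
  Kronecker substitution: on the curve \<open>(s, s^N, s^(N^2), \<dots>)\<close> a monomial with exponents below \<open>N\<close>
  becomes the power of \<open>s\<close> whose exponent has these exponents as base \<open>N\<close> digits. Distinct
  monomials stay distinct, so a nonzero polynomial restricts to a nonzero polynomial in \<open>s\<close>,
  which cannot vanish on an infinite field.
\<close>

lemma peval_eq_0_imp_eq_0:
  assumes p: "p \<in> carrier (QPoly m)"
    and vanish: "\<And>u :: 'a::field_char_0 list. length u = m \<Longrightarrow> peval p u = 0"
  shows "p = 0"
proof (rule ccontr)
  assume "p \<noteq> 0"
  define K where "K = Poly_Mapping.keys p"
  have fin: "finite K" and keys: "t \<in> K \<Longrightarrow> Poly_Mapping.keys t \<subseteq> {..<m}" for t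
    using p by (auto simp: K_def QPoly_def)
  \<comment> \<open>A base that exceeds every exponent occurring in \<open>p\<close>.\<close>
  define N where "N = Suc (\<Sum>t\<in>K. \<Sum>i<m. Poly_Mapping.lookup t i)"
  have less_N: "Poly_Mapping.lookup t i < N" if "t \<in> K" "i < m" for t i
  proof -
    have "Poly_Mapping.lookup t i \<le> (\<Sum>i<m. Poly_Mapping.lookup t i)"
      using that by (intro member_le_sum) auto
    also have "\<dots> \<le> (\<Sum>t\<in>K. \<Sum>i<m. Poly_Mapping.lookup t i)"
      using that fin by (intro member_le_sum[of t K "\<lambda>t. \<Sum>i<m. Poly_Mapping.lookup t i"]) auto
    finally show ?thesis by (simp add: N_def)
  qed
  define e where "e t = (\<Sum>i<m. Poly_Mapping.lookup t i * N ^ i)" for t :: "nat \<Rightarrow>\<^sub>0 nat"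
  have inj: "inj_on e K"
  proof (rule inj_onI, rule poly_mapping_eqI)
    fix s t i assume st: "s \<in> K" "t \<in> K" "e s = e t"
    show "Poly_Mapping.lookup s i = Poly_Mapping.lookup t i"
    proof (cases "i < m")
      case True
      then show ?thesis
        using digits_unique[where a = "Poly_Mapping.lookup s" and b = "Poly_Mapping.lookup t"
            and m = m and N = N and i = i] st less_N
        by (simp add: e_def)
    next
      case False
      then show ?thesis using keys[OF st(1)] keys[OF st(2)]
        by (metis in_keys_iff lessThan_iff subsetD)
    qed
  qed
  define P :: "'a poly" where "P = (\<Sum>t\<in>K. monom (of_rat (Poly_Mapping.lookup p t)) (e t))"
  have "poly P s = 0" for s
  proof -
    let ?u = "map (\<lambda>i. s ^ (N ^ i)) [0..<m]"
    have "monomial_value ?u t = s ^ e t" if "t \<in> K" for t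
    proof -
      have "monomial_value ?u t = (\<Prod>i<m. (?u ! i) ^ Poly_Mapping.lookup t i)"
        using keys[OF that] by (intro monomial_value_superset) auto
      then show ?thesis by (simp add: e_def power_sum mult.commute[of "Poly_Mapping.lookup t _"] power_mult)
    qed
    then have "peval p ?u = poly P s"
      by (simp add: peval_monomials P_def poly_sum poly_monom K_def)
    with vanish[of ?u] show ?thesis by simp
  qed
  then have "P = 0" using poly_all_0_iff_0 by blast
  from \<open>p \<noteq> 0\<close> obtain t where t: "t \<in> K" by (metis K_def in_keys_iff lookup_zero poly_mapping_eqI)
  have "coeff P (e t) = (\<Sum>s\<in>K. if s = t then of_rat (Poly_Mapping.lookup p s) else 0)"
    unfolding P_def coeff_sum using inj t by (intro sum.cong) (auto simp: inj_on_eq_iff)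
  also have "\<dots> = of_rat (Poly_Mapping.lookup p t)" using fin t by simp
  finally show False using t \<open>P = 0\<close> by (simp add: K_def in_keys_iff)
qed

lemma peval_first_variable:
  fixes v :: "'a::field_char_0 list"
  obtains P :: "'a poly" where "\<And>a. poly P a = peval p (a # v)"
proof
  fix a
  show "poly (\<Sum>t\<in>Poly_Mapping.keys p. smult (of_rat (Poly_Mapping.lookup p t))
      (\<Prod>i\<in>Poly_Mapping.keys t. (case i of 0 \<Rightarrow> [:0, 1:] | Suc j \<Rightarrow> [:v ! j:]) ^ Poly_Mapping.lookup t i)) a
    = peval p (a # v)"
    unfolding peval_def poly_sum poly_smult poly_prod poly_power
    by (intro sum.cong prod.cong arg_cong2[where f = "(*)"] arg_cong2[where f = power] refl)
       (simp split: nat.split)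
qed

section \<open>Polynomial rings and function fields\<close>

lemma QPoly_simps [simp]:
  "\<one>\<^bsub>QPoly m\<^esub> = 1" "\<zero>\<^bsub>QPoly m\<^esub> = 0" "p \<otimes>\<^bsub>QPoly m\<^esub> q = p * q" "p \<oplus>\<^bsub>QPoly m\<^esub> q = p + q"
  by (simp_all add: QPoly_def)

lemma QPoly_closed [intro, simp]:
  "0 \<in> carrier (QPoly m)" "1 \<in> carrier (QPoly m)"
  "i < m \<Longrightarrow> Var i \<in> carrier (QPoly m)"
  "p \<in> carrier (QPoly m) \<Longrightarrow> - p \<in> carrier (QPoly m)"
  "p \<in> carrier (QPoly m) \<Longrightarrow> q \<in> carrier (QPoly m) \<Longrightarrow> p + q \<in> carrier (QPoly m)"
  "p \<in> carrier (QPoly m) \<Longrightarrow> q \<in> carrier (QPoly m) \<Longrightarrow> p * q \<in> carrier (QPoly m)"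
proof -
  show "p + q \<in> carrier (QPoly m)" if "p \<in> carrier (QPoly m)" "q \<in> carrier (QPoly m)"
    using that Poly_Mapping.keys_add[of p q] by (auto simp: QPoly_def)
  show "p * q \<in> carrier (QPoly m)" if pq: "p \<in> carrier (QPoly m)" "q \<in> carrier (QPoly m)"
  proof -
    have "Poly_Mapping.keys t \<subseteq> {..<m}" if "t \<in> Poly_Mapping.keys (p * q)" for t
    proof -
      have "t \<in> {r + s | r s. r \<in> Poly_Mapping.keys p \<and> s \<in> Poly_Mapping.keys q}"
        using that keys_mult[of p q] by blast
      then obtain r s where "r \<in> Poly_Mapping.keys p" "s \<in> Poly_Mapping.keys q" "t = r + s"
        by blast
      then show ?thesis using pq Poly_Mapping.keys_add[of r s] unfolding QPoly_def by force
    qed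
    then show ?thesis by (simp add: QPoly_def)
  qed
qed (auto simp: QPoly_def Var_def in_keys_iff)

lemma QPoly_domain: "domain (QPoly m)"
proof (rule domainI)
  show "cring (QPoly m)"
  proof (rule cringI)
    show "abelian_group (QPoly m)"
    proof (rule abelian_groupI)
      fix p assume "p \<in> carrier (QPoly m)"
      then show "\<exists>q\<in>carrier (QPoly m). q \<oplus>\<^bsub>QPoly m\<^esub> p = \<zero>\<^bsub>QPoly m\<^esub>"
        by (intro bexI[of _ "- p"]) auto
    qed (auto simp: add_ac)
    show "comm_monoid (QPoly m)"
      by (rule comm_monoidI) (auto simp: mult_ac)
  qed (auto simp: algebra_simps)
qed auto

lemma QPoly_power [simp]:
  assumes "p \<in> carrier (QPoly m)"
  shows "p ^ k \<in> carrier (QPoly m)"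
  using assms by (induction k) auto

lemma QPoly_numeral [simp]: "numeral k \<in> carrier (QPoly m)"
proof -
  have "of_nat n \<in> carrier (QPoly m)" for n by (induction n) auto
  then show ?thesis by (metis of_nat_numeral)
qed

lemma QPoly_diff [simp]:
  assumes "p \<in> carrier (QPoly m)" "q \<in> carrier (QPoly m)"
  shows "p - q \<in> carrier (QPoly m)"
  using QPoly_closed(5)[OF assms(1) QPoly_closed(4)[OF assms(2)]] by simp

context
  fixes m P assumes P: "primeideal P (QPoly m)"
begin

interpretation QP: domain "QPoly m" by (rule QPoly_domain)
interpretation P: primeideal P "QPoly m" by (rule P)
interpretation C: domain "coord_ring m P"
  unfolding coord_ring_def by (rule P.quotient_is_domain)

lemma function_field_field: "field (function_field m P)"
  unfolding function_field_def by (rule C.Frac_field)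

lemma to_function_field_ring_hom:
  "to_function_field m P \<in> ring_hom (QPoly m) (function_field m P)"
  using ring_hom_trans[OF P.rcos_ring_hom C.mk_frac_ring_hom[unfolded coord_ring_def]]
  by (simp add: to_function_field_def[abs_def] function_field_def coord_ring_def o_def)

lemma to_function_field_eq_0_iff:
  assumes "p \<in> carrier (QPoly m)"
  shows "to_function_field m P p = \<zero>\<^bsub>function_field m P\<^esub> \<longleftrightarrow> p \<in> P"
proof -
  have "P +>\<^bsub>QPoly m\<^esub> p \<in> carrier (coord_ring m P)"
    using assms by (auto simp: coord_ring_def FactRing_def A_RCOSETS_def')
  then have "to_function_field m P p = \<zero>\<^bsub>function_field m P\<^esub> \<longleftrightarrow> P +>\<^bsub>QPoly m\<^esub> p = \<zero>\<^bsub>coord_ring m P\<^esub>"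
    by (simp add: to_function_field_def function_field_def C.mk_frac_simps)
  also have "\<dots> \<longleftrightarrow> p \<in> P"
    using P.a_rcos_const[of p] P.a_rcos_self[OF assms]
    by (auto simp: coord_ring_def FactRing_def)
  finally show ?thesis .
qed

lemma function_field_cases:
  assumes "x \<in> carrier (function_field m P)"
  obtains p q where "p \<in> carrier (QPoly m)" "q \<in> carrier (QPoly m)" "q \<notin> P"
    "x = to_function_field m P p \<otimes>\<^bsub>function_field m P\<^esub>
         inv\<^bsub>function_field m P\<^esub> to_function_field m P q"
proof -
  obtain a b where ab: "a \<in> carrier (coord_ring m P)"
      "b \<in> carrier (coord_ring m P) - {\<zero>\<^bsub>coord_ring m P\<^esub>}"
    and x: "x = mk_frac (coord_ring m P) a \<one>\<^bsub>coord_ring m P\<^esub> \<otimes>\<^bsub>function_field m P\<^esub>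
      inv\<^bsub>function_field m P\<^esub> mk_frac (coord_ring m P) b \<one>\<^bsub>coord_ring m P\<^esub>"
    using assms C.Frac_quotient unfolding function_field_def by metis
  obtain p q where pq: "p \<in> carrier (QPoly m)" "q \<in> carrier (QPoly m)"
      "a = P +>\<^bsub>QPoly m\<^esub> p" "b = P +>\<^bsub>QPoly m\<^esub> q"
    using ab by (auto simp: coord_ring_def FactRing_def A_RCOSETS_def')
  have "q \<notin> P" using ab pq P.a_rcos_const[of q] by (auto simp: coord_ring_def FactRing_def)
  then show thesis using that[OF pq(1,2)] x by (simp add: to_function_field_def pq)
qed

end

text \<open>
  Rational constants are built from 1 by sums, negation and inverses of units. Hence a property
  that is preserved by the ring operations and passes to inverses of units holds for all
  polynomials once it holds for the variables. In this form constants need no case of their own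
  when the property is membership in a subfield.
\<close>

lemma QPoly_induct [consumes 1, case_names one Var minus add mult inverse]:
  assumes p: "p \<in> carrier (QPoly n)"
    and one: "Q 1"
    and Var: "\<And>i. i < n \<Longrightarrow> Q (Var i)"
    and minus: "\<And>p. p \<in> carrier (QPoly n) \<Longrightarrow> Q p \<Longrightarrow> Q (- p)"
    and add: "\<And>p q. p \<in> carrier (QPoly n) \<Longrightarrow> q \<in> carrier (QPoly n) \<Longrightarrow> Q p \<Longrightarrow> Q q \<Longrightarrow> Q (p + q)"
    and mult: "\<And>p q. p \<in> carrier (QPoly n) \<Longrightarrow> q \<in> carrier (QPoly n) \<Longrightarrow> Q p \<Longrightarrow> Q q \<Longrightarrow> Q (p * q)"
    and inverse: "\<And>p q. p \<in> carrier (QPoly n) \<Longrightarrow> q \<in> carrier (QPoly n) \<Longrightarrow> p * q = 1 \<Longrightarrow> Q p \<Longrightarrow> Q q"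
  shows "Q p"
proof -
  let ?c = "\<lambda>r. Poly_Mapping.single 0 r :: qpoly"
  define A where "A = {p \<in> carrier (QPoly n). Q p}"
  have A_one: "1 \<in> A" and A_Var: "i < n \<Longrightarrow> Var i \<in> A" and A_minus: "p \<in> A \<Longrightarrow> - p \<in> A"
    and A_add: "p \<in> A \<Longrightarrow> q \<in> A \<Longrightarrow> p + q \<in> A" and A_mult: "p \<in> A \<Longrightarrow> q \<in> A \<Longrightarrow> p * q \<in> A"
    for p q i
    using assms by (auto simp: A_def)
  have A_zero: "0 \<in> A" using A_add[OF A_one A_minus[OF A_one]] by simp
  have A_of_nat: "?c (of_nat k) \<in> A" for k
  proof (induction k)
    case (Suc k)
    then show ?case using A_add[OF A_one] by (simp add: single_add)
  qed (simp add: A_zero)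
  have A_of_int: "?c (of_int k) \<in> A" for k
  proof (cases k)
    case (neg j)
    then show ?thesis using A_minus[OF A_of_nat[of "Suc j"]]
      by (simp only: of_int_minus of_int_of_nat_eq single_uminus)
  qed (use A_of_nat in simp)
  have A_const: "?c r \<in> A" for r
  proof (cases r)
    case (Fract a b)
    have "?c s * ?c (inverse s) = 1" if "s \<noteq> 0" for s using that by (simp add: mult_single)
    from this[of "of_int b"] have "?c (of_int b) * ?c (inverse (of_int b)) = 1"
      using Fract(2) by simp
    moreover have "?c (inverse (of_int b)) \<in> carrier (QPoly n)" by (auto simp: QPoly_def)
    ultimately have "?c (inverse (of_int b)) \<in> A"
      using inverse A_of_int[of b] by (auto simp: A_def)
    from A_mult[OF A_of_int[of a] this] have "?c (of_int a * inverse (of_int b)) \<in> A"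
      unfolding mult_single by simp
    then show ?thesis using Fract by (simp add: Fract_of_int_quotient divide_inverse)
  qed
  have A_var_power: "Poly_Mapping.single (Poly_Mapping.single i k) 1 \<in> A" if "i < n" for i k
  proof (induction k)
    case (Suc k)
    have "Poly_Mapping.single (Poly_Mapping.single i (Suc k)) 1
        = Var i * Poly_Mapping.single (Poly_Mapping.single i k) (1 :: rat)"
      by (simp add: Var_def mult_single flip: single_add)
    then show ?case using A_mult[OF A_Var[OF that] Suc] by simp
  qed (simp add: A_one)
  have A_monomial: "Poly_Mapping.single t 1 \<in> A" if "Poly_Mapping.keys t \<subseteq> {..<n}" for t
  proof -
    have "Poly_Mapping.single (\<Sum>i\<in>I. Poly_Mapping.single i (Poly_Mapping.lookup t i)) 1 \<in> A"
      if "I \<subseteq> {..<n}" for I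
      using finite_subset[OF that finite_lessThan] that
    proof (induction I rule: finite_induct)
      case (insert i I)
      then have "Poly_Mapping.single (Poly_Mapping.single i (Poly_Mapping.lookup t i)) 1
          * Poly_Mapping.single (\<Sum>i\<in>I. Poly_Mapping.single i (Poly_Mapping.lookup t i)) 1 \<in> A"
        by (intro A_mult A_var_power) auto
      then show ?case using insert.hyps unfolding mult_single by simp
    qed (simp add: A_one)
    from this[OF that] show ?thesis by (simp add: sum_monomials)
  qed
  have A_sum: "(\<Sum>t\<in>I. f t) \<in> A" if "\<And>t. t \<in> I \<Longrightarrow> f t \<in> A" for I and f :: "_ \<Rightarrow> qpoly"
    using that by (induction I rule: infinite_finite_induct) (auto simp: A_zero A_add)
  have "Poly_Mapping.single t (Poly_Mapping.lookup p t) \<in> A" if "t \<in> Poly_Mapping.keys p" for t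
    using A_mult[OF A_const[of "Poly_Mapping.lookup p t"] A_monomial[of t]] that p
    by (auto simp: mult_single QPoly_def)
  then have "p \<in> A" using A_sum sum_monomials[of p] by metis
  then show ?thesis by (simp add: A_def)
qed

lemma hom_mem_subfield:
  assumes "field L" "subfield E L" and h: "h \<in> ring_hom (QPoly n) L"
    and vars: "\<And>i. i < n \<Longrightarrow> h (Var i) \<in> E" and p: "p \<in> carrier (QPoly n)"
  shows "h p \<in> E"
proof -
  interpret L: field L by fact
  interpret QP: domain "QPoly n" by (rule QPoly_domain)
  interpret h: ring_hom_ring "QPoly n" L h
    using h by (intro ring_hom_ringI2 QP.ring_axioms L.ring_axioms)
  note E = subringE[OF subfieldE(1)[OF \<open>subfield E L\<close>]]
  note EL = subsetD[OF E(1)]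
  show ?thesis
    using p
  proof (induction p rule: QPoly_induct)
    case one
    then show ?case using E(3) h.hom_one by simp
  next
    case (minus p)
    have "h (- p) \<oplus>\<^bsub>L\<^esub> h p = \<zero>\<^bsub>L\<^esub>"
      using minus h.hom_add[of "- p" p] h.hom_zero by simp
    then have "h (- p) = \<ominus>\<^bsub>L\<^esub> h p"
      using minus h.hom_closed by (intro L.minus_equality[symmetric]) auto
    then show ?case using minus E(5) by simp
  next
    case (add p q)
    then show ?case using E(7) h.hom_add[of p q] by simp
  next
    case (mult p q)
    then show ?case using E(6) h.hom_mult[of p q] by simp
  next
    case (inverse p q)
    have pq: "h p \<otimes>\<^bsub>L\<^esub> h q = \<one>\<^bsub>L\<^esub>"
      using inverse h.hom_mult[of p q] h.hom_one by simp
    then have "h q = inv\<^bsub>L\<^esub> h p" "h p \<noteq> \<zero>\<^bsub>L\<^esub>"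
      using inverse h.hom_closed[of p] h.hom_closed[of q] L.comm_inv_char[of "h p" "h q"] by auto
    then show ?case using L.subfield_m_inv(1)[OF \<open>subfield E L\<close>, of "h p"] inverse by simp
  qed (simp add: vars)
qed

lemma primeideal_zero: "primeideal {0} (QPoly m)"
  using domain.zeroprimeideal[OF QPoly_domain] by simp

lemma to_function_field_inj: "inj_on (to_function_field m {0}) (carrier (QPoly m))"
proof -
  interpret QP: domain "QPoly m" by (rule QPoly_domain)
  interpret K: field "function_field m {0}" by (intro function_field_field primeideal_zero)
  interpret h: ring_hom_ring "QPoly m" "function_field m {0}" "to_function_field m {0}"
    by (intro ring_hom_ringI2 QP.ring_axioms K.ring_axioms to_function_field_ring_hom primeideal_zero)
  have "a_kernel (QPoly m) (function_field m {0}) (to_function_field m {0}) = {\<zero>\<^bsub>QPoly m\<^esub>}"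
    unfolding a_kernel_def' using to_function_field_eq_0_iff[OF primeideal_zero] by fastforce
  then show ?thesis by (rule h.trivial_ker_imp_inj)
qed

lemma function_field_affine_space_generated:
  assumes "subfield E (function_field m {0})"
    and "\<And>i. i < m \<Longrightarrow> to_function_field m {0} (Var i) \<in> E"
  shows "E = carrier (function_field m {0})"
proof
  let ?K = "function_field m {0}" and ?\<phi> = "to_function_field m {0}"
  interpret K: field ?K by (intro function_field_field primeideal_zero)
  note E = subringE[OF subfieldE(1)[OF assms(1)]]
  show "E \<subseteq> carrier ?K" by (rule E(1))
  have poly: "?\<phi> p \<in> E" if "p \<in> carrier (QPoly m)" for p
    by (rule hom_mem_subfield[OF K.field_axioms assms(1)
          to_function_field_ring_hom[OF primeideal_zero] assms(2) that])
  show "carrier ?K \<subseteq> E"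
  proof
    fix x assume "x \<in> carrier ?K"
    then obtain p q where pq: "p \<in> carrier (QPoly m)" "q \<in> carrier (QPoly m)" "q \<noteq> 0"
      and x: "x = ?\<phi> p \<otimes>\<^bsub>?K\<^esub> inv\<^bsub>?K\<^esub> ?\<phi> q"
      using function_field_cases[OF primeideal_zero] by (metis singletonI)
    have "?\<phi> q \<in> E - {\<zero>\<^bsub>?K\<^esub>}"
      using poly pq by (simp add: to_function_field_eq_0_iff primeideal_zero)
    then show "x \<in> E"
      using poly[OF pq(1)] K.subfield_m_inv(1)[OF assms(1)] E(6) x by blast
  qed
qed

text \<open>
  The coordinate functions are a transcendence basis. They even generate the function field.
\<close>

lemma affine_space_has_dim: "has_dim m {0} m"
proof -
  let ?K = "function_field m {0}" and ?\<phi> = "to_function_field m {0}"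
  interpret K: field ?K by (intro function_field_field primeideal_zero)
  let ?b = "\<lambda>i. ?\<phi> (Var i)"
  have hom: "?\<phi> \<in> ring_hom (QPoly m) ?K"
    by (intro to_function_field_ring_hom primeideal_zero)
  have carr: "?b ` {..<m} \<subseteq> carrier ?K" using ring_hom_closed[OF hom] by auto
  let ?E = "generate_field ?K (?b ` {..<m})"
  have sub: "subfield ?E ?K" by (rule K.generate_field_is_subfield[OF carr])
  have "?E = carrier ?K"
    by (rule function_field_affine_space_generated[OF sub]) (auto intro: generate_field.incl)
  then have "\<forall>x\<in>carrier ?K. K.algebraic ?E x"
    using K.algebraic_self[OF subfieldE(1)[OF sub]] by (auto simp: over_def)
  moreover have "alg_independent ?K m ?b"
    using hom to_function_field_inj by (auto simp: alg_independent_def)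
  ultimately show ?thesis by (auto simp: has_dim_def has_trdeg_def)
qed

lemma zero_locus_zero [simp]: "zero_locus m {0} = affine_space m"
  by (auto simp: zero_locus_def)

section \<open>The cubic cover\<close>

lemma thin_type1_hyperplane:
  assumes "i < n"
  shows "thin_type1 n {u \<in> affine_space n. u ! i = 0}"
  unfolding thin_type1_def
proof (intro exI conjI)
  interpret QP: domain "QPoly n" by (rule QPoly_domain)
  let ?I = "PIdl\<^bsub>QPoly n\<^esub> (Var i)"
  have Var: "Var i \<in> carrier (QPoly n)" using assms by simp
  show "ideal ?I (QPoly n)" by (rule QP.cgenideal_ideal[OF Var])
  have "Var i \<in> ?I" by (rule QP.cgenideal_self[OF Var])
  then have "replicate n 1 \<notin> (zero_locus n ?I :: complex list set)"
    using assms by (auto simp: zero_locus_def intro!: bexI[of _ "Var i"])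
  moreover have "replicate n 1 \<in> affine_space n" by (simp add: affine_space_def)
  ultimately show "(zero_locus n ?I :: complex list set) \<noteq> affine_space n" by metis
  show "{u \<in> affine_space n. u ! i = 0} \<subseteq> zero_locus n ?I"
    by (auto simp: zero_locus_def cgenideal_def)
qed

text \<open>
  For \<open>x \<noteq> 0\<close>, put \<open>u = 1 + x y\<close> and solve the third coordinate of \<open>F\<close> for \<open>z\<close>, which gives
  \<open>x^3 z = 5 x - 3 x u - c\<close>. The other two coordinates become
  \<open>b = 4 t + 2 / x - 3 c t^2\<close> and \<open>a = t^2 + t / x - c t^3\<close> with \<open>t = u / x\<close>, and eliminating
  \<open>1 / x\<close> leaves \<open>c t^3 - 2 t^2 + b t = 2 a\<close>. The substitution \<open>t = 2 s\<close> removes the factor 2 in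
  front of \<open>a\<close>. The variables 0, 1, 2 stand for \<open>s, b, c\<close>.
\<close>

definition cubic :: qpoly where
  "cubic = 4 * Var 2 * Var 0 ^ 3 - 4 * Var 0 ^ 2 + Var 1 * Var 0"

definition root_cover :: "qpoly list" where
  "root_cover = [cubic, Var 1, Var 2]"

lemma cubic_closed [simp]: "cubic \<in> carrier (QPoly 3)"
  by (simp add: cubic_def)

lemma apply_root_cover:
  "apply_morphism root_cover [s, b, c] = [4 * c * s ^ 3 - 4 * s ^ 2 + b * s, b, c]"
  by (simp add: apply_morphism_def root_cover_def cubic_def)

lemma length_3_cases:
  assumes "length u = 3"
  obtains a b c where "u = [a, b, c]"
  using assms by (auto simp: length_Suc_conv numeral_3_eq_3)

text \<open>
  The equation for \<open>s\<close> has the coefficient \<open>-4\<close> at \<open>s^2\<close>, so it is never constant and has a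
  complex root even where \<open>c\<close> or \<open>b\<close> vanishes.
\<close>

lemma root_cover_surj:
  fixes a b c :: complex
  obtains s where "apply_morphism root_cover [s, b, c] = [a, b, c]"
proof -
  let ?p = "[:- a, b, - 4, 4 * c:]"
  have "Polynomial.degree ?p \<noteq> 0" by simp
  then have "\<not> Fundamental_Theorem_Algebra.constant (poly ?p)" by (simp only: constant_degree not_False_eq_True)
  from fundamental_theorem_of_algebra[OF this] obtain s where "poly ?p s = 0" ..
  then have "4 * c * s ^ 3 - 4 * s ^ 2 + b * s = a"
    by (simp add: algebra_simps power2_eq_square power3_eq_cube)
  then show thesis using that by (simp add: apply_root_cover)
qed

lemma root_cover_dominant: "dominant 3 {0} root_cover"
  unfolding dominant_def
proof (intro ballI impI)
  fix g assume g: "g \<in> carrier (QPoly (length root_cover))"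
    and vanish: "\<forall>u\<in>(zero_locus 3 {0} :: complex list set). peval g (apply_morphism root_cover u) = 0"
  show "g = 0"
  proof (rule peval_eq_0_imp_eq_0[where 'a = complex])
    show "g \<in> carrier (QPoly 3)" using g by (simp add: root_cover_def numeral_3_eq_3)
    fix u :: "complex list" assume "length u = 3"
    then obtain a b c where u: "u = [a, b, c]" by (rule length_3_cases)
    obtain s where "apply_morphism root_cover [s, b, c] = [a, b, c]" by (rule root_cover_surj)
    then show "peval g u = 0"
      using vanish[rule_format, of "[s, b, c]"] by (simp add: u affine_space_def)
  qed
qed

text \<open>
  The coordinate ring of the target, viewed inside that of the source: the polynomials that factor
  through the cover. The factorisation is stated for the values at complex points, which avoids
  substituting polynomials into polynomials.
\<close>

definition cover_pullbacks :: "qpoly set" where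
  "cover_pullbacks = {N \<in> carrier (QPoly 3). \<exists>p\<in>carrier (QPoly 3). \<forall>s b c :: complex.
      peval N [s, b, c] = peval p (apply_morphism root_cover [s, b, c])}"

lemma cover_pullbacks_subring: "subring cover_pullbacks (QPoly 3)"
proof -
  interpret QP: domain "QPoly 3" by (rule QPoly_domain)
  have uminus: "\<ominus>\<^bsub>QPoly 3\<^esub> p = - p" if "p \<in> carrier (QPoly 3)" for p
    using that by (intro QP.minus_equality) auto
  show ?thesis
  proof (rule QP.subringI)
    show "\<one>\<^bsub>QPoly 3\<^esub> \<in> cover_pullbacks"
      by (auto simp: cover_pullbacks_def intro!: bexI[of _ 1])
    fix p assume "p \<in> cover_pullbacks"
    then obtain p' where p_in: "p' \<in> carrier (QPoly 3)" and p: "p \<in> carrier (QPoly 3)" and p':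
        "\<And>s b c :: complex. peval p [s, b, c] = peval p' (apply_morphism root_cover [s, b, c])"
      by (auto simp: cover_pullbacks_def)
    show "\<ominus>\<^bsub>QPoly 3\<^esub> p \<in> cover_pullbacks"
      using p_in p p' by (auto simp: cover_pullbacks_def uminus intro!: bexI[of _ "- p'"])
    fix q assume "q \<in> cover_pullbacks"
    then obtain q' where q_in: "q' \<in> carrier (QPoly 3)" and q: "q \<in> carrier (QPoly 3)" and q':
        "\<And>s b c :: complex. peval q [s, b, c] = peval q' (apply_morphism root_cover [s, b, c])"
      by (auto simp: cover_pullbacks_def)
    show "p \<oplus>\<^bsub>QPoly 3\<^esub> q \<in> cover_pullbacks"
      using p_in p p' q_in q q' by (auto simp: cover_pullbacks_def intro!: bexI[of _ "p' + q'"])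
    show "p \<otimes>\<^bsub>QPoly 3\<^esub> q \<in> cover_pullbacks"
      using p_in p p' q_in q q' by (auto simp: cover_pullbacks_def intro!: bexI[of _ "p' * q'"])
  qed (auto simp: cover_pullbacks_def)
qed

lemma root_cover_subset_pullbacks: "set root_cover \<subseteq> cover_pullbacks"
proof -
  have "cubic \<in> cover_pullbacks"
    by (auto simp: cover_pullbacks_def apply_root_cover cubic_def intro!: bexI[of _ "Var 0"])
  moreover have "Var 1 \<in> cover_pullbacks"
    by (auto simp: cover_pullbacks_def apply_root_cover intro!: bexI[of _ "Var 1"])
  moreover have "Var 2 \<in> cover_pullbacks"
    by (auto simp: cover_pullbacks_def apply_root_cover intro!: bexI[of _ "Var 2"])
  ultimately show ?thesis by (simp add: root_cover_def)
qed

text \<open>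
  Fix \<open>b\<close> and \<open>c \<noteq> 0\<close>. The first coordinate of the cover is then a polynomial \<open>f\<close> of degree 3 in
  \<open>s\<close>, so \<open>D\<close> and \<open>N\<close> restrict to polynomials \<open>Q(f(s))\<close> and \<open>P(f(s))\<close>, whose degrees are
  multiples of 3. This contradicts \<open>s Q(f(s)) = P(f(s))\<close> unless \<open>Q = 0\<close>.
\<close>

lemma root_not_fraction_of_pullbacks:
  assumes N: "N \<in> cover_pullbacks" and D: "D \<in> cover_pullbacks" and eq: "Var 0 * D = N"
  shows "D = 0"
proof (rule ccontr)
  assume "D \<noteq> 0"
  obtain p q where p: "\<And>s b c :: complex. peval N [s, b, c] = peval p (apply_morphism root_cover [s, b, c])"
    and q: "\<And>s b c :: complex. peval D [s, b, c] = peval q (apply_morphism root_cover [s, b, c])"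
    using N D by (auto simp: cover_pullbacks_def)
  \<comment> \<open>The factor \<open>Var 2\<close> gives a point where \<open>D\<close> and the leading coefficient \<open>4 c\<close> of the cubic
    are both nonzero.\<close>
  have "D * Var 2 \<noteq> 0" using \<open>D \<noteq> 0\<close> Var_nonzero by simp
  moreover have "D * Var 2 \<in> carrier (QPoly 3)" using D by (simp add: cover_pullbacks_def)
  ultimately obtain u :: "complex list" where "length u = 3" "peval (D * Var 2) u \<noteq> 0"
    using peval_eq_0_imp_eq_0 by blast
  then obtain s\<^sub>0 b c where D_nz: "peval D [s\<^sub>0, b, c] \<noteq> 0" and c: "c \<noteq> (0::complex)"
    by (elim length_3_cases) auto
  obtain P where P: "\<And>a. poly P a = peval p [a, b, c]"
    using peval_first_variable[where v = "[b, c]" and p = p] by blast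
  obtain Q where Q: "\<And>a. poly Q a = peval q [a, b, c]"
    using peval_first_variable[where v = "[b, c]" and p = q] by blast
  define f where "f = [:0, b, - 4, 4 * c:]"
  have f: "[poly f s, b, c] = apply_morphism root_cover [s, b, c]" for s
    by (simp add: f_def apply_root_cover algebra_simps power2_eq_square power3_eq_cube)
  have "poly (pCons 0 (pcompose Q f)) s = poly (pcompose P f) s" for s
    using arg_cong[OF eq, of "\<lambda>r. peval r [s, b, c]"] by (simp add: poly_pcompose P Q f p q)
  then have eq_poly: "pCons 0 (pcompose Q f) = pcompose P f"
    by (simp add: poly_eq_poly_eq_iff[symmetric] fun_eq_iff)
  have "poly (pcompose Q f) s\<^sub>0 \<noteq> 0" using D_nz by (simp add: poly_pcompose Q f q)
  then have "pcompose Q f \<noteq> 0" by auto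
  then have "Suc (Polynomial.degree Q * 3) = Polynomial.degree P * 3"
    using arg_cong[OF eq_poly, of Polynomial.degree] c by (simp add: degree_pcompose f_def)
  then show False by presburger
qed

text \<open>
  The function field of the source is generated by \<open>s\<close> over that of the target, since \<open>b\<close> and
  \<open>c\<close> are coordinates of both. This generator is algebraic because it satisfies the cubic equation, and
  the extension is proper by the degree count above.
\<close>

lemma root_cover_generically_finite:
  "\<exists>d\<ge>2. generically_finite_of_degree 3 {0} root_cover d"
proof -
  let ?K = "function_field 3 {0}" and ?\<phi> = "to_function_field 3 {0}"
  let ?E = "generate_field ?K (?\<phi> ` set root_cover)"
  interpret QP: domain "QPoly 3" by (rule QPoly_domain)
  interpret K: field ?K by (intro function_field_field primeideal_zero)
  interpret h: ring_hom_ring "QPoly 3" ?K ?\<phi>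
    by (intro ring_hom_ringI2 QP.ring_axioms K.ring_axioms to_function_field_ring_hom primeideal_zero)
  have cover_carrier: "set root_cover \<subseteq> carrier (QPoly 3)" by (simp add: root_cover_def)
  have E: "subfield ?E ?K"
    using cover_carrier h.hom_closed by (intro K.generate_field_is_subfield) blast
  note E_ring = subringE[OF subfieldE(1)[OF E]]
  have s: "?\<phi> (Var 0) \<in> carrier ?K" by simp
  have gens: "?\<phi> cubic \<in> ?E" "?\<phi> (Var 1) \<in> ?E" "?\<phi> (Var 2) \<in> ?E"
    by (auto intro!: generate_field.incl simp: root_cover_def)
  have add: "?\<phi> (p + q) = ?\<phi> p \<oplus>\<^bsub>?K\<^esub> ?\<phi> q"
    and mult: "?\<phi> (p * q) = ?\<phi> p \<otimes>\<^bsub>?K\<^esub> ?\<phi> q"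
    if "p \<in> carrier (QPoly 3)" "q \<in> carrier (QPoly 3)" for p q
    using that h.hom_add[of p q] h.hom_mult[of p q] by simp_all
  have minus_mem: "?\<phi> (- p) \<in> ?E" if "p \<in> carrier (QPoly 3)" "?\<phi> p \<in> ?E" for p
  proof -
    have "?\<phi> (- p) \<oplus>\<^bsub>?K\<^esub> ?\<phi> p = \<zero>\<^bsub>?K\<^esub>"
      using that add[of "- p" p] h.hom_zero by simp
    then have "?\<phi> (- p) = \<ominus>\<^bsub>?K\<^esub> ?\<phi> p"
      using that h.hom_closed by (intro K.minus_equality[symmetric]) auto
    then show ?thesis using that E_ring(5) by simp
  qed
  have "?\<phi> 1 \<in> ?E" using E_ring(3) h.hom_one by simp
  then have "?\<phi> (1 + 1) \<in> ?E" using E_ring(7) add[of 1 1] by simp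
  then have "?\<phi> (2 + 2) \<in> ?E" using E_ring(7) add[of 2 2] by simp
  then have four: "?\<phi> 4 \<in> ?E" by simp
  have lead: "?\<phi> (4 * Var 2) \<in> ?E" using four gens E_ring(6) mult[of 4 "Var 2"] by simp
  have lead_nz: "?\<phi> (4 * Var 2) \<noteq> \<zero>\<^bsub>?K\<^esub>"
    by (subst to_function_field_eq_0_iff) (auto simp: primeideal_zero Var_nonzero)
  \<comment> \<open>Coefficients are listed from the leading one down.\<close>
  let ?p = "[?\<phi> (4 * Var 2), ?\<phi> (- 4), ?\<phi> (Var 1), ?\<phi> (- cubic)]"
  have p: "?p \<in> carrier (univ_poly ?K ?E)"
    using lead lead_nz minus_mem[OF _ four] minus_mem[OF _ gens(1)] gens
    by (simp add: univ_poly_def polynomial_def)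
  have pow: "?\<phi> (Var 0) [^]\<^bsub>?K\<^esub> k = ?\<phi> (Var 0 ^ k)" for k :: nat
  proof (induction k)
    case (Suc k)
    then show ?case using mult[of "Var 0 ^ k" "Var 0"] by (simp add: mult.commute)
  qed (use h.hom_one in simp)
  have "K.eval ?p (?\<phi> (Var 0)) =
      ?\<phi> (4 * Var 2 * Var 0 ^ 3 + (- 4 * Var 0 ^ 2 + (Var 1 * Var 0 + (- cubic))))"
    by (simp add: pow mult[symmetric] add[symmetric] power2_eq_square power3_eq_cube)
  also have "4 * Var 2 * Var 0 ^ 3 + (- 4 * Var 0 ^ 2 + (Var 1 * Var 0 + (- cubic))) = 0"
    by (simp add: cubic_def)
  also have "?\<phi> 0 = \<zero>\<^bsub>?K\<^esub>" using h.hom_zero by simp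
  finally have "(K.algebraic over ?E) (?\<phi> (Var 0))"
    by (intro K.algebraicI[OF p]) auto
  moreover have "?\<phi> (Var 0) \<notin> ?E"
  proof
    assume "?\<phi> (Var 0) \<in> ?E"
    then obtain N D where ND: "N \<in> cover_pullbacks" "D \<in> cover_pullbacks" "?\<phi> D \<noteq> \<zero>\<^bsub>?K\<^esub>"
        "?\<phi> (Var 0) \<otimes>\<^bsub>?K\<^esub> ?\<phi> D = ?\<phi> N"
      using h.generate_field_fractions[OF K.field_axioms cover_pullbacks_subring
          root_cover_subset_pullbacks] by blast
    then have carr: "N \<in> carrier (QPoly 3)" "D \<in> carrier (QPoly 3)"
      by (auto simp: cover_pullbacks_def)
    then have "?\<phi> (Var 0 * D) = ?\<phi> N" using ND mult[of "Var 0" D] by simp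
    then have "Var 0 * D = N"
      using inj_onD[OF to_function_field_inj] carr by simp
    then have "D = 0" using root_not_fraction_of_pullbacks ND by blast
    then show False using ND(3) \<open>?\<phi> 0 = \<zero>\<^bsub>?K\<^esub>\<close> by simp
  qed
  moreover have "E' = carrier ?K" if E': "subfield E' ?K" "?E \<subseteq> E'" "?\<phi> (Var 0) \<in> E'" for E'
  proof (rule function_field_affine_space_generated[OF E'(1)])
    fix i :: nat assume "i < 3"
    then consider "i = 0" | "i = 1" | "i = 2" by linarith
    then show "?\<phi> (Var i) \<in> E'" using E' gens by cases auto
  qed
  ultimately have "\<exists>d\<ge>2. K.dimension d ?E (carrier ?K)"
    using s by (intro K.dimension_ge_2_of_simple_extension[OF E, of "?\<phi> (Var 0)"]) auto
  then show ?thesis by (simp add: generically_finite_of_degree_def)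
qed

lemma thin_type2_root_cover: "thin_type2 3 (apply_morphism root_cover ` affine_space 3)"
proof -
  obtain d where "generically_finite_of_degree 3 {0} root_cover d" "d \<ge> 2"
    using root_cover_generically_finite by blast
  moreover have "morphism 3 3 root_cover" by (simp add: morphism_def root_cover_def)
  ultimately show ?thesis
    unfolding thin_type2_def
    by (intro exI[of _ 3] exI[of _ "{0}"] exI[of _ root_cover] exI[of _ d])
       (simp add: primeideal_zero affine_space_has_dim root_cover_dominant)
qed

section \<open>The image of the map\<close>

lemma Fmap_in_root_cover_image:
  assumes "x \<noteq> 0"
  shows "Fmap x y z \<in> apply_morphism root_cover ` affine_space 3"
proof -
  define s where "s = (1 + x * y) / (2 * x)"
  define b where "b = y + 3 * x * (1 + x * y) ^ 2 * z + 3 * x * y ^ 2 * (4 + 3 * x * y)"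
  define c where "c = 2 * x - 3 * x ^ 2 * y - x ^ 3 * z"
  have xs: "2 * x * s = 1 + x * y" using assms by (simp add: s_def)
  \<comment> \<open>Clearing denominators makes \<open>s\<close> occur only through \<open>2 x s = 1 + x y\<close>.\<close>
  have "(2 * x) ^ 3 * (4 * c * s ^ 3 - 4 * s ^ 2 + b * s) =
      4 * c * (2 * x * s) ^ 3 - 8 * x * (2 * x * s) ^ 2 + 4 * x ^ 2 * b * (2 * x * s)"
    by (simp add: algebra_simps power2_eq_square power3_eq_cube)
  also have "\<dots> = (2 * x) ^ 3 * ((1 + x * y) ^ 3 * z + y ^ 2 * (1 + x * y) * (4 + 3 * x * y))"
    unfolding xs b_def c_def by (simp add: algebra_simps power2_eq_square power3_eq_cube)
  finally have "4 * c * s ^ 3 - 4 * s ^ 2 + b * s =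
      (1 + x * y) ^ 3 * z + y ^ 2 * (1 + x * y) * (4 + 3 * x * y)"
    using assms by simp
  then have "Fmap x y z = apply_morphism root_cover [s, b, c]"
    by (simp add: Fmap_def apply_root_cover b_def c_def)
  then show ?thesis by (simp add: affine_space_def)
qed

theorem corollary6p1:
  shows "thin 3 {Fmap x y z | x y z. True} \<and>
    (\<exists>T. thin 3 T \<and>
      (\<forall>a b c. [a, b, c] \<notin> T \<longrightarrow> {(x, y, z). Fmap x y z = [a, b, c]} = {}))"
proof -
  let ?H = "{u \<in> affine_space 3. u ! 2 = (0 :: rat)}"
  let ?C = "apply_morphism root_cover ` affine_space 3 :: rat list set"
  have "Fmap x y z \<in> ?H \<union> ?C" for x y z
  proof (cases "x = 0")
    case True
    then show ?thesis by (simp add: Fmap_def affine_space_def)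
  next
    case False
    then show ?thesis by (intro UnI2 Fmap_in_root_cover_image)
  qed
  then have "{Fmap x y z | x y z. True} \<subseteq> \<Union>{?H, ?C}" by (simp only: Union_insert Union_empty Un_empty_right) auto
  moreover have "{Fmap x y z | x y z. True} \<subseteq> affine_space 3"
    by (auto simp: Fmap_def affine_space_def)
  moreover have "thin_type1 3 ?H" by (rule thin_type1_hyperplane) simp
  ultimately have "thin 3 {Fmap x y z | x y z. True}"
    unfolding thin_def using thin_type2_root_cover
    by (intro conjI exI[of _ "{?H, ?C}"]) simp_all
  \<comment> \<open>The image itself serves as the exceptional set.\<close>
  moreover have "{(x, y, z). Fmap x y z = [a, b, c]} = {}"
    if "[a, b, c] \<notin> {Fmap x y z | x y z. True}" for a b c
    using that by (auto, metis)
  ultimately show ?thesis by blast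
qed

end
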